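(* Let $T\in(0,\infty)$, $\alpha\in(\frac13,\frac12]$, $\beta\in(0,\infty)$, $q\in(0,\infty]$. Let $X\in B^\alpha_{\Phi_\beta,q}([0,T];\mathbb R)$ and let $F\in B^{2\alpha;2}_{\Phi_{\beta/2},q/2}([0,T];\mathbb R)$ be additive, i.e. $F_{s,t}-F_{s,u}-F_{u,t}=0$ for all $0\le s\le u\le t\le T$. Define $$\mathbb X_{s,t}=\frac{(X_t-X_s)^2}{2}+F_{s,t},\qquad 0\le s\le t\le T.$$ Then $\mathbb X\in B^{2\alpha;2}_{\Phi_{\beta/2},q/2}([0,T];\mathbb R)$ and $\mathbb X$ satisfies Chen's relations $$\mathbb X_{s,t}-\mathbb X_{s,u}-\mathbb X_{u,t}=(X_u-X_s)(X_t-X_u),\qquad 0\le s\le u\le t\le T.$$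
   Context: **Orlicz norm.** For $\beta\in(0,\infty)$ put $x_\beta=((1-\beta)/\beta)^{1/\beta}$ if $\beta<1$, $x_\beta=0$ if $\beta\ge1$; $\Psi_\beta(x)=e^{x^\beta}-1$; $E_\beta(x)=\Psi_\beta(x)$ for $x\ge x_\beta$, $E_\beta(x)=\Psi_\beta(x_\beta)+\Psi_\beta'(x_\beta)(x-x_\beta)$ for $0\le x<x_\beta$; $\Phi_\beta(x)=E_\beta(x)-E_\beta(0)$. For a bounded interval $D$ and measurable $g:D\to\mathbb R$, $\|g\|_{L^{\Phi_\beta}(D)}=\inf\{\lambda>0:\int_D\Phi_\beta(|g_r|/\lambda)\,\mathrm dr\le1\}$. **Spaces.** For $\alpha\in(0,\infty)$, $q\in(0,\infty]$, $B^{\alpha;2}_{\Phi_\beta,q}([0,T];\mathbb R)$ is the space of measurable $\varXi:\{(s,t):0\le s\le t\le T\}\to\mathbb R$ (identified if for all $h\in[0,T]$ they agree at $(r,r+h)$ for a.a. $r\in[0,T-h]$) with $\|\varXi\|_{B^{\alpha;2}_{\Phi_\beta,q}}=\big\|\tau^{-\alpha}\sup_{h\in[0,\tau]}\|\varXi_{\cdot,\cdot+h}\|_{L^{\Phi_\beta}([0,T-h])}\big\|_{L^q([0,T],\mathrm d\tau/\tau)}<\infty$. For $\alpha\in(0,1)$, $B^\alpha_{\Phi_\beta,q}([0,T];\mathbb R)$ is the space of measurable $f:[0,T]\to\mathbb R$ with $\|f\|_{L^{\Phi_\beta}([0,T])}<\infty$ such that $\delta f_{s,t}=f_t-f_s$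 satisfies $\|\delta f\|_{B^{\alpha;2}_{\Phi_\beta,q}}<\infty$ (identified with their continuous representatives). Convention: $\infty/2=\infty$. *)

theory Defs
  imports "HOL-Analysis.Analysis" "HOL-Probability.Essential_Supremum"
begin

section \<open>The Orlicz norm\<close>

definition x_beta :: "real \<Rightarrow> real" where
  "x_beta \<beta> = (if \<beta> < 1 then ((1 - \<beta>) / \<beta>) powr (1 / \<beta>) else 0)"

definition Psi :: "real \<Rightarrow> real \<Rightarrow> real" where
  "Psi \<beta> x = exp (x powr \<beta>) - 1"

text \<open>The following functions are meant for arguments \<open>x \<ge> 0\<close>. The tangent branch is only
  reachable there if \<open>x_beta \<beta> > 0\<close>, where \<open>Psi \<beta>\<close> is differentiable.\<close>

definition E_beta :: "real \<Rightarrow> real \<Rightarrow> real" where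
  "E_beta \<beta> x =
     (if x_beta \<beta> \<le> x then Psi \<beta> x
      else Psi \<beta> (x_beta \<beta>) + deriv (Psi \<beta>) (x_beta \<beta>) * (x - x_beta \<beta>))"

definition Phi :: "real \<Rightarrow> real \<Rightarrow> real" where
  "Phi \<beta> x = E_beta \<beta> x - E_beta \<beta> 0"

text \<open>The infimum is taken in \<open>[0, \<infinity>]\<close>; it is \<open>\<infinity>\<close> if no admissible \<open>l\<close> exists.\<close>

definition orlicz_norm :: "real \<Rightarrow> real set \<Rightarrow> (real \<Rightarrow> real) \<Rightarrow> ennreal" where
  "orlicz_norm \<beta> D g =
     Inf {ennreal l | l. 0 < l \<and> (\<integral>\<^sup>+ r\<in>D. ennreal (Phi \<beta> (\<bar>g r\<bar> / l)) \<partial>lborel) \<le> 1}"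


section \<open>The \<open>L\<^sup>q\<close> quasi-norm, \<open>0 < q \<le> \<infinity>\<close>\<close>

text \<open>Power of an extended nonnegative real with a positive exponent.\<close>

definition ennpow :: "ennreal \<Rightarrow> real \<Rightarrow> ennreal" where
  "ennpow x p = (if x = \<infinity> then \<infinity> else ennreal (enn2real x powr p))"

definition Lq_norm :: "'a measure \<Rightarrow> ennreal \<Rightarrow> ('a \<Rightarrow> ennreal) \<Rightarrow> ennreal" where
  "Lq_norm M q f =
     (if q = \<infinity> then esssup M f
      else ennpow (\<integral>\<^sup>+ x. ennpow (f x) (enn2real q) \<partial>M) (1 / enn2real q))"

text \<open>The measure \<open>d\<tau>/\<tau>\<close> on \<open>[0, T]\<close>.\<close>

definition log_measure :: "real \<Rightarrow> real measure" where
  "log_measure T = density (restrict_space lborel {0..T}) (\<lambda>\<tau>. ennreal (1 / \<tau>))"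


section \<open>Besov--Orlicz spaces\<close>

definition simplex2 :: "real \<Rightarrow> (real \<times> real) set" where
  "simplex2 T = {(s, t). 0 \<le> s \<and> s \<le> t \<and> t \<le> T}"

definition besov2_norm ::
    "real \<Rightarrow> real \<Rightarrow> real \<Rightarrow> ennreal \<Rightarrow> (real \<Rightarrow> real \<Rightarrow> real) \<Rightarrow> ennreal" where
  "besov2_norm T \<alpha> \<beta> q \<Xi> =
     Lq_norm (log_measure T) q
       (\<lambda>\<tau>. ennreal (\<tau> powr (- \<alpha>)) *
            (SUP h\<in>{0..\<tau>}. orlicz_norm \<beta> {0..T - h} (\<lambda>r. \<Xi> r (r + h))))"

text \<open>Both spaces below are rendered as sets of representatives: a function belongs to the set iff
  it is measurable and its equivalence class has finite norm, the norms being independent of the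
  representative. Values outside of the simplex, respectively of \<open>[0, T]\<close>, are irrelevant.
  In particular \<open>besov\<close> contains the continuous representative of each class, but it is not
  restricted to continuous functions.\<close>

definition besov2 :: "real \<Rightarrow> real \<Rightarrow> real \<Rightarrow> ennreal \<Rightarrow> (real \<Rightarrow> real \<Rightarrow> real) set" where
  "besov2 T \<alpha> \<beta> q =
     {\<Xi>. (\<lambda>(s, t). \<Xi> s t) \<in> borel_measurable (restrict_space borel (simplex2 T)) \<and>
          besov2_norm T \<alpha> \<beta> q \<Xi> < \<infinity>}"

definition incr :: "(real \<Rightarrow> real) \<Rightarrow> real \<Rightarrow> real \<Rightarrow> real" where
  "incr f s t = f t - f s"

definition besov :: "real \<Rightarrow> real \<Rightarrow> real \<Rightarrow> ennreal \<Rightarrow> (real \<Rightarrow> real) set" where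
  "besov T \<alpha> \<beta> q =
     {f. f \<in> borel_measurable (restrict_space borel {0..T}) \<and>
         orlicz_norm \<beta> {0..T} f < \<infinity> \<and>
         besov2_norm T \<alpha> \<beta> q (incr f) < \<infinity>}"

end

theory Submission
  imports Defs
begin

text \<open>
  Chen's relation is the polarisation identity
  \<open>(a + b)\<^sup>2 / 2 - a\<^sup>2 / 2 - b\<^sup>2 / 2 = a * b\<close> for consecutive increments of \<open>X\<close>; the additive
  part \<open>F\<close> cancels. The content is the bound on the norm.

  The parameters \<open>2 * \<alpha>\<close>, \<open>\<beta> / 2\<close> and \<open>q / 2\<close> are what squaring produces. In the Orlicz scale
  \<open>exp ((x\<^sup>2) powr (\<beta> / 2)) = exp (x powr \<beta>)\<close>, so that \<open>\<Phi>\<close> with exponent \<open>\<beta> / 2\<close>, evaluated at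
  \<open>x\<^sup>2\<close>, behaves for large \<open>x\<close> like \<open>\<Phi>\<close> with exponent \<open>\<beta>\<close> at \<open>x\<close>. Near \<open>0\<close>,
  where \<open>\<Phi>\<close> is linear for an exponent below \<open>1\<close> and a power otherwise, the former has at least
  the order of the latter, so it is still dominated up to constants (lemma
  \<open>Phi_power_dominated\<close>). Hence the Orlicz norm of \<open>g\<^sup>2\<close> with exponent \<open>\<beta> / 2\<close> is at most a
  constant times the square of the norm of \<open>g\<close> with exponent \<open>\<beta>\<close>, uniformly in the domain. The
  same lemma lets \<open>\<Phi>\<close> absorb constant factors, which yields a quasi-triangle inequality from
  monotonicity of \<open>\<Phi>\<close> alone (lemma \<open>orlicz_norm_square_add\<close>).

  Taking suprema over \<open>h\<close> and multiplying by \<open>\<tau> powr (- 2 * \<alpha>) = (\<tau> powr (- \<alpha>))\<^sup>2\<close>, the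
  integrand that defines the norm of \<open>\<X>\<close> is pointwise at most \<open>C * (f\<^sup>2 + g)\<close>, where \<open>f\<close> and \<open>g\<close>
  are the integrands for \<open>X\<close> and \<open>F\<close>. Since \<open>f\<^sup>2\<close> is in \<open>L\<close> with exponent \<open>q / 2\<close> iff \<open>f\<close> is in
  \<open>L\<close> with exponent \<open>q\<close>, the claim follows (lemma \<open>Lq_norm_square_add_finite\<close>).
\<close>

section \<open>The Young functions\<close>

lemma Psi_mono:
  assumes "0 < \<beta>" "0 \<le> x" "x \<le> y"
  shows "Psi \<beta> x \<le> Psi \<beta> y"
  using assms by (simp add: Psi_def powr_mono2)

lemma Psi_nonneg: "0 \<le> Psi \<beta> x"
  by (simp add: Psi_def)

text \<open>This is convexity of \<open>exp\<close> between the points \<open>0\<close> and \<open>t\<close>.\<close>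

lemma exp_minus_one_scale:
  fixes c t :: real
  assumes "0 \<le> c" "c \<le> 1"
  shows "exp (c * t) - 1 \<le> c * (exp t - 1)"
proof -
  have "exp ((1 - c) *\<^sub>R 0 + c *\<^sub>R t) \<le> (1 - c) * exp 0 + c * exp t"
    by (rule convex_onD[OF exp_convex]) (use assms in auto)
  then show ?thesis by (simp add: algebra_simps)
qed

lemma x_beta_pos: "0 < \<beta> \<Longrightarrow> \<beta> < 1 \<Longrightarrow> 0 < x_beta \<beta>"
  by (simp add: x_beta_def)

lemma x_beta_powr:
  assumes "0 < \<beta>" "\<beta> < 1"
  shows "x_beta \<beta> powr \<beta> = (1 - \<beta>) / \<beta>"
  using assms by (simp add: x_beta_def powr_powr)

definition tangent_slope :: "real \<Rightarrow> real" where
  "tangent_slope \<beta> = \<beta> * x_beta \<beta> powr (\<beta> - 1) * exp ((1 - \<beta>) / \<beta>)"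

lemma tangent_slope_pos: "0 < \<beta> \<Longrightarrow> \<beta> < 1 \<Longrightarrow> 0 < tangent_slope \<beta>"
  using x_beta_pos[of \<beta>] by (simp add: tangent_slope_def)

lemma deriv_Psi_x_beta:
  assumes "0 < \<beta>" "\<beta> < 1"
  shows "deriv (Psi \<beta>) (x_beta \<beta>) = tangent_slope \<beta>"
proof (rule DERIV_imp_deriv)
  have "((\<lambda>x. exp (x powr \<beta>) - 1) has_real_derivative tangent_slope \<beta>) (at (x_beta \<beta>))"
    using x_beta_pos[OF assms]
    by (auto intro!: derivative_eq_intros simp: tangent_slope_def x_beta_powr[OF assms])
  then show "(Psi \<beta> has_real_derivative tangent_slope \<beta>) (at (x_beta \<beta>))"
    by (simp add: Psi_def[abs_def])
qed

lemma tangent_slope_x_beta: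
  assumes "0 < \<beta>" "\<beta> < 1"
  shows "tangent_slope \<beta> * x_beta \<beta> = (1 - \<beta>) * exp ((1 - \<beta>) / \<beta>)"
proof -
  have "x_beta \<beta> powr (\<beta> - 1) * x_beta \<beta> = x_beta \<beta> powr \<beta>"
    using x_beta_pos[OF assms] by (simp add: powr_diff)
  then have "tangent_slope \<beta> * x_beta \<beta> = \<beta> * ((1 - \<beta>) / \<beta>) * exp ((1 - \<beta>) / \<beta>)"
    by (simp add: tangent_slope_def x_beta_powr[OF assms] mult.assoc mult.left_commute)
  then show ?thesis using assms by simp
qed

lemma Phi_eq_Psi:
  assumes "1 \<le> \<beta>" "0 \<le> x"
  shows "Phi \<beta> x = Psi \<beta> x"
  using assms by (simp add: Phi_def E_beta_def x_beta_def Psi_def)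

lemma Phi_below:
  assumes "0 < \<beta>" "\<beta> < 1" "x < x_beta \<beta>"
  shows "Phi \<beta> x = tangent_slope \<beta> * x"
  using assms x_beta_pos[OF assms(1,2)]
  by (simp add: Phi_def E_beta_def deriv_Psi_x_beta algebra_simps)

lemma Phi_above:
  assumes "0 < \<beta>" "\<beta> < 1" "x_beta \<beta> \<le> x"
  shows "Phi \<beta> x = exp (x powr \<beta>) - \<beta> * exp ((1 - \<beta>) / \<beta>)"
proof -
  have "Phi \<beta> x = Psi \<beta> x - (Psi \<beta> (x_beta \<beta>) - tangent_slope \<beta> * x_beta \<beta>)"
    using assms x_beta_pos[OF assms(1,2)]
    by (simp add: Phi_def E_beta_def deriv_Psi_x_beta)
  then show ?thesis
    unfolding Psi_def tangent_slope_x_beta[OF assms(1,2)] x_beta_powr[OF assms(1,2)]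
    by (simp add: left_diff_distrib)
qed

lemma Phi_above_le_Psi:
  assumes "0 < \<beta>" "\<beta> < 1" "x_beta \<beta> \<le> x"
  shows "Phi \<beta> x \<le> Psi \<beta> x"
proof -
  have "1 + (1 - \<beta>) / \<beta> \<le> exp ((1 - \<beta>) / \<beta>)" by (rule exp_ge_add_one_self)
  then have "1 \<le> \<beta> * exp ((1 - \<beta>) / \<beta>)" using assms by (simp add: field_simps)
  then show ?thesis by (simp add: Phi_above[OF assms] Psi_def)
qed

text \<open>Above the inflection point the constant that is subtracted is at most the fraction \<open>\<beta>\<close> of
  \<open>exp (x powr \<beta>)\<close>.\<close>

lemma Psi_le_Phi_above:
  assumes "0 < \<beta>" "\<beta> < 1" "x_beta \<beta> \<le> x"
  shows "(1 - \<beta>) * Psi \<beta> x \<le> Phi \<beta> x"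
proof -
  have "(1 - \<beta>) / \<beta> \<le> x powr \<beta>"
    using powr_mono2[of \<beta> "x_beta \<beta>" x] assms x_beta_pos[OF assms(1,2)]
    by (simp add: x_beta_powr[OF assms(1,2)])
  then have "\<beta> * exp ((1 - \<beta>) / \<beta>) \<le> \<beta> * exp (x powr \<beta>)" using assms by simp
  then have "(1 - \<beta>) * exp (x powr \<beta>) \<le> Phi \<beta> x"
    by (simp add: Phi_above[OF assms] algebra_simps)
  then show ?thesis using assms by (simp add: Psi_def algebra_simps)
qed

lemma Phi_mono:
  assumes "0 < \<beta>" "0 \<le> x" "x \<le> y"
  shows "Phi \<beta> x \<le> Phi \<beta> y"
proof (cases "\<beta> < 1")
  case False
  then show ?thesis using assms Psi_mono[OF assms] by (simp add: Phi_eq_Psi)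
next
  case True
  note b = assms(1) True
  have above: "Phi \<beta> u \<le> Phi \<beta> y" if "x_beta \<beta> \<le> u" "u \<le> y" for u
    using that powr_mono2[of \<beta> u y] b x_beta_pos[OF b] by (simp add: Phi_above[OF b])
  show ?thesis
  proof (cases "y < x_beta \<beta>")
    case True
    then show ?thesis using assms tangent_slope_pos[OF b] by (simp add: Phi_below[OF b])
  next
    case y: False
    show ?thesis
    proof (cases "x < x_beta \<beta>")
      case True
      have "Phi \<beta> x \<le> tangent_slope \<beta> * x_beta \<beta>"
        using True tangent_slope_pos[OF b] by (simp add: Phi_below[OF b])
      also have "\<dots> = Phi \<beta> (x_beta \<beta>)"
        by (simp add: Phi_above[OF b] tangent_slope_x_beta[OF b] x_beta_powr[OF b] left_diff_distrib)
      also have "\<dots> \<le> Phi \<beta> y" using y by (intro above) auto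
      finally show ?thesis .
    qed (use assms in \<open>auto intro: above\<close>)
  qed
qed

lemma Phi_nonneg:
  assumes "0 < \<beta>" "0 \<le> x"
  shows "0 \<le> Phi \<beta> x"
  using Phi_mono[of \<beta> 0 x] assms by (simp add: Phi_def)

lemma Phi_measurable [measurable]: "Phi \<beta> \<in> borel_measurable borel"
  unfolding Phi_def[abs_def] E_beta_def[abs_def] Psi_def[abs_def] by measurable

text \<open>Replacing a concave initial piece by a line costs at most a constant factor, because
  \<open>x powr \<beta>\<close> dominates a linear function on a bounded interval when \<open>\<beta> < 1\<close>.\<close>

lemma Phi_le_Psi:
  assumes "0 < \<beta>"
  obtains A where "1 \<le> A" and "\<And>x. 0 \<le> x \<Longrightarrow> Phi \<beta> x \<le> A * Psi \<beta> x"
proof (cases "\<beta> < 1")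
  case False
  then show ?thesis by (intro that[of 1]) (auto simp: Phi_eq_Psi)
next
  case True
  note b = assms True
  define A where "A = max 1 (tangent_slope \<beta> * x_beta \<beta> powr (1 - \<beta>))"
  have "Phi \<beta> x \<le> A * Psi \<beta> x" if "0 \<le> x" for x
  proof (cases "x < x_beta \<beta>")
    case False
    then have "Phi \<beta> x \<le> 1 * Psi \<beta> x" using Phi_above_le_Psi[OF b] by simp
    also have "\<dots> \<le> A * Psi \<beta> x" by (intro mult_right_mono Psi_nonneg) (simp add: A_def)
    finally show ?thesis .
  next
    case small: True
    have "Phi \<beta> x = tangent_slope \<beta> * (x powr (1 - \<beta>) * x powr \<beta>)"
      using that small by (simp add: Phi_below[OF b] flip: powr_add)
    also have "\<dots> \<le> tangent_slope \<beta> * (x_beta \<beta> powr (1 - \<beta>) * x powr \<beta>)"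
      using that small b tangent_slope_pos[OF b]
      by (intro mult_left_mono mult_right_mono powr_mono2) auto
    also have "\<dots> \<le> A * x powr \<beta>"
      unfolding mult.assoc[symmetric] by (intro mult_right_mono) (auto simp: A_def)
    also have "A * x powr \<beta> \<le> A * Psi \<beta> x"
    proof (rule mult_left_mono)
      show "x powr \<beta> \<le> Psi \<beta> x"
        unfolding Psi_def using exp_ge_add_one_self[of "x powr \<beta>"] by linarith
    qed (simp add: A_def)
    finally show ?thesis .
  qed
  then show ?thesis by (intro that[of A]) (auto simp: A_def)
qed

text \<open>The comparison behind both uses of the Young functions: \<open>n = 1\<close> converts the norm of a square
  into the square of a norm, and \<open>n = 0\<close> lets a small factor in the argument produce a small factor
  in front. Outside the linear regime of the right hand side, both sides are compared with
  \<open>Psi \<beta> x\<close>, where \<open>\<beta> = \<gamma> * Suc n\<close> is the exponent that \<open>x ^ Suc n\<close> produces under \<open>\<gamma>\<close>. In that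
  regime \<open>k\<close> can be taken so small that the left hand side is in its
  linear regime, too, and \<open>x ^ Suc n\<close> is bounded by a multiple of \<open>x\<close> there.\<close>

lemma Phi_power_dominated:
  fixes \<gamma> \<epsilon> :: real and n :: nat
  assumes "0 < \<gamma>" "0 < \<epsilon>"
  obtains k where "0 < k" and "\<And>x. 0 \<le> x \<Longrightarrow> Phi \<gamma> (k * x ^ Suc n) \<le> \<epsilon> * Phi (\<gamma> * real (Suc n)) x"
proof -
  define \<beta> where "\<beta> = \<gamma> * real (Suc n)"
  have \<beta>: "0 < \<beta>" "\<gamma> \<le> \<beta>" using assms mult_left_mono[of 1 "real (Suc n)" \<gamma>] by (auto simp: \<beta>_def)
  obtain A where A: "1 \<le> A" "\<And>x. 0 \<le> x \<Longrightarrow> Phi \<gamma> x \<le> A * Psi \<gamma> x"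
    using Phi_le_Psi[OF assms(1)] by metis
  have large: "Phi \<gamma> (k * x ^ Suc n) \<le> A * k powr \<gamma> * Psi \<beta> x" if "0 < k" "k \<le> 1" "0 \<le> x" for k x
  proof -
    have "(x ^ Suc n) powr \<gamma> = x powr \<beta>"
    proof (cases "x = 0")
      case False
      then have "(x ^ Suc n) powr \<gamma> = (x powr real (Suc n)) powr \<gamma>"
        using that by (subst powr_realpow) auto
      then show ?thesis by (simp add: powr_powr \<beta>_def mult.commute)
    qed simp
    then have "Psi \<gamma> (k * x ^ Suc n) = exp (k powr \<gamma> * x powr \<beta>) - 1"
      using that by (simp add: Psi_def powr_mult del: power_Suc)
    also have "\<dots> \<le> k powr \<gamma> * (exp (x powr \<beta>) - 1)"
      using that assms by (intro exp_minus_one_scale) (auto simp: powr_le1)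
    finally have "A * Psi \<gamma> (k * x ^ Suc n) \<le> A * (k powr \<gamma> * Psi \<beta> x)"
      using A(1) by (intro mult_left_mono) (auto simp: Psi_def)
    then show ?thesis using A(2)[of "k * x ^ Suc n"] that by (simp add: mult.assoc)
  qed
  \<comment> \<open>All conditions on \<open>k\<close> below hold for every sufficiently small \<open>k > 0\<close>, so they can be met
    together.\<close>
  have small_coeff: "eventually (\<lambda>k. A * k powr \<gamma> < c) (at_right 0)" if "0 < c" for c
  proof -
    have "((\<lambda>k. A * k powr \<gamma>) \<longlongrightarrow> A * 0 powr \<gamma>) (at_right 0)"
      using assms by (intro tendsto_intros tendsto_powr2) (auto simp: eventually_at_right_less eventually_at_filter)
    then show ?thesis using that by (intro order_tendstoD) auto
  qed
  have small_lin: "eventually (\<lambda>k. k * B < c) (at_right 0)" if "0 < c" for c B :: real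
  proof -
    have "((\<lambda>k. k * B) \<longlongrightarrow> 0 * B) (at_right 0)" by (intro tendsto_intros)
    then show ?thesis using that by (intro order_tendstoD) auto
  qed
  have range: "eventually (\<lambda>k. 0 < k \<and> k < (1::real)) (at_right 0)"
    using eventually_at_right_real[of 0 1] by simp
  show ?thesis
  proof (cases "\<beta> < 1")
    case False
    have "eventually (\<lambda>k. A * k powr \<gamma> < \<epsilon> \<and> 0 < k \<and> k < 1) (at_right 0)"
      using small_coeff[OF assms(2)] range by eventually_elim auto
    from eventually_happens'[OF trivial_limit_at_right_real this]
    obtain k where k: "A * k powr \<gamma> < \<epsilon>" "0 < k" "k < 1"
      by blast
    show ?thesis
    proof (rule that[OF k(2)])
      fix x :: real assume x: "0 \<le> x"
      have "Phi \<gamma> (k * x ^ Suc n) \<le> \<epsilon> * Psi \<beta> x"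
        using large[of k x] mult_right_mono[OF less_imp_le[OF k(1)] Psi_nonneg[of \<beta> x]] k x
        by linarith
      then show "Phi \<gamma> (k * x ^ Suc n) \<le> \<epsilon> * Phi (\<gamma> * real (Suc n)) x"
        using False x Phi_eq_Psi[of \<beta> x] by (simp add: \<beta>_def)
    qed
  next
    case True
    note b = \<beta>(1) True
    have g: "0 < \<gamma>" "\<gamma> < 1" using assms \<beta> True by auto
    have "eventually (\<lambda>k. A * k powr \<gamma> < \<epsilon> * (1 - \<beta>) \<and> k * x_beta \<beta> ^ Suc n < x_beta \<gamma> \<and>
        k * (tangent_slope \<gamma> * x_beta \<beta> ^ n) < \<epsilon> * tangent_slope \<beta> \<and> 0 < k \<and> k < 1) (at_right 0)"
      using small_coeff[of "\<epsilon> * (1 - \<beta>)"] range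
        small_lin[OF x_beta_pos[OF g], of "x_beta \<beta> ^ Suc n"]
        small_lin[of "\<epsilon> * tangent_slope \<beta>" "tangent_slope \<gamma> * x_beta \<beta> ^ n"]
        assms True tangent_slope_pos[OF b]
      by (auto simp: eventually_conj_iff)
    from eventually_happens'[OF trivial_limit_at_right_real this]
    obtain k where k: "A * k powr \<gamma> < \<epsilon> * (1 - \<beta>)" "k * x_beta \<beta> ^ Suc n < x_beta \<gamma>"
        "k * (tangent_slope \<gamma> * x_beta \<beta> ^ n) < \<epsilon> * tangent_slope \<beta>" "0 < k" "k < 1"
      by blast
    show ?thesis
    proof (rule that[OF k(4)], fold \<beta>_def)
      fix x :: real assume x: "0 \<le> x"
      show "Phi \<gamma> (k * x ^ Suc n) \<le> \<epsilon> * Phi \<beta> x"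
      proof (cases "x < x_beta \<beta>")
        case small: True
        have "k * x ^ Suc n \<le> k * x_beta \<beta> ^ Suc n"
          using x small k by (intro mult_left_mono power_mono) auto
        then have "k * x ^ Suc n < x_beta \<gamma>" using k(2) by linarith
        then have "Phi \<gamma> (k * x ^ Suc n) = k * (tangent_slope \<gamma> * x ^ n) * x"
          by (simp add: Phi_below[OF g] mult_ac)
        also have "\<dots> \<le> k * (tangent_slope \<gamma> * x_beta \<beta> ^ n) * x"
          using x small k tangent_slope_pos[OF g]
          by (intro mult_right_mono mult_left_mono power_mono) auto
        also have "\<dots> \<le> \<epsilon> * tangent_slope \<beta> * x"
          using k(3) x by (intro mult_right_mono) auto
        finally show ?thesis by (simp add: Phi_below[OF b small])
      next
        case False
        have "Phi \<gamma> (k * x ^ Suc n) \<le> \<epsilon> * (1 - \<beta>) * Psi \<beta> x"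
          using large[of k x] mult_right_mono[OF less_imp_le[OF k(1)] Psi_nonneg[of \<beta> x]] k x
          by linarith
        also have "\<dots> \<le> \<epsilon> * Phi \<beta> x"
          using Psi_le_Phi_above[OF b, of x] False assms by simp
        finally show ?thesis .
      qed
    qed
  qed
qed

section \<open>Orlicz norms of squares and sums\<close>

lemma orlicz_norm_admissible:
  assumes "0 < \<beta>" "orlicz_norm \<beta> D g < ennreal a"
  shows "0 < a \<and> (\<integral>\<^sup>+ r\<in>D. ennreal (Phi \<beta> (\<bar>g r\<bar> / a)) \<partial>lborel) \<le> 1"
proof -
  obtain l where l: "0 < l" "ennreal l < ennreal a"
      "(\<integral>\<^sup>+ r\<in>D. ennreal (Phi \<beta> (\<bar>g r\<bar> / l)) \<partial>lborel) \<le> 1"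
    using assms(2) unfolding orlicz_norm_def Inf_less_iff by auto
  have la: "l < a" using l by (simp add: ennreal_less_iff)
  have "(\<integral>\<^sup>+ r\<in>D. ennreal (Phi \<beta> (\<bar>g r\<bar> / a)) \<partial>lborel)
      \<le> (\<integral>\<^sup>+ r\<in>D. ennreal (Phi \<beta> (\<bar>g r\<bar> / l)) \<partial>lborel)"
    using la l(1)
    by (intro nn_integral_mono mult_right_mono ennreal_leI Phi_mono assms divide_left_mono) auto
  then show ?thesis using l la by auto
qed

lemma orlicz_norm_le:
  assumes "0 < l" "(\<integral>\<^sup>+ r\<in>D. ennreal (Phi \<beta> (\<bar>g r\<bar> / l)) \<partial>lborel) \<le> 1"
  shows "orlicz_norm \<beta> D g \<le> ennreal l"
  unfolding orlicz_norm_def using assms by (intro Inf_lower) auto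

lemma orlicz_norm_cong:
  assumes "\<And>r. r \<in> D \<Longrightarrow> f r = g r"
  shows "orlicz_norm \<beta> D f = orlicz_norm \<beta> D g"
proof -
  have "(\<integral>\<^sup>+ r\<in>D. ennreal (Phi \<beta> (\<bar>f r\<bar> / l)) \<partial>lborel)
      = (\<integral>\<^sup>+ r\<in>D. ennreal (Phi \<beta> (\<bar>g r\<bar> / l)) \<partial>lborel)" for l
    using assms by (intro nn_integral_cong) (auto simp: indicator_def)
  then show ?thesis by (simp add: orlicz_norm_def)
qed

text \<open>In place of convexity, a sum is bounded by twice the larger summand, so that \<open>\<Phi>\<close> of a sum is
  at most the sum of the values of \<open>\<Phi>\<close> at the doubled summands; the factor \<open>1/2\<close> that makes the
  two integrals add up to at most \<open>1\<close> comes from \<open>Phi_power_dominated\<close>. The constant depends on \<open>\<beta>\<close> only, which allows taking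
  the supremum over the domains \<open>{0..T - h}\<close> afterwards.\<close>

lemma orlicz_norm_square_add:
  assumes "0 < \<beta>"
  obtains C where "0 < C" and "\<And>D g f. D \<in> sets borel \<Longrightarrow>
    g \<in> borel_measurable (restrict_space borel D) \<Longrightarrow>
    f \<in> borel_measurable (restrict_space borel D) \<Longrightarrow>
    orlicz_norm (\<beta> / 2) D (\<lambda>r. (g r)\<^sup>2 / 2 + f r)
      \<le> ennreal C * ((orlicz_norm \<beta> D g)\<^sup>2 + orlicz_norm (\<beta> / 2) D f)"
proof -
  define \<gamma> where "\<gamma> = \<beta> / 2"
  have \<gamma>: "0 < \<gamma>" using assms by (simp add: \<gamma>_def)
  obtain k where k: "0 < k" "\<And>x. 0 \<le> x \<Longrightarrow> Phi \<gamma> (k * x\<^sup>2) \<le> 1/2 * Phi \<beta> x"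
    using Phi_power_dominated[OF \<gamma>, of "1/2" 1] by (auto simp: \<gamma>_def numeral_2_eq_2)
  obtain k' where k': "0 < k'" "\<And>x. 0 \<le> x \<Longrightarrow> Phi \<gamma> (k' * x) \<le> 1/2 * Phi \<gamma> x"
    using Phi_power_dominated[OF \<gamma>, of "1/2" 0] by auto
  define C where "C = 1 / k + 2 / k'"
  have C: "0 < C" using k(1) k'(1) by (simp add: C_def add_pos_pos)
  have "orlicz_norm \<gamma> D (\<lambda>r. (g r)\<^sup>2 / 2 + f r)
      \<le> ennreal C * ((orlicz_norm \<beta> D g)\<^sup>2 + orlicz_norm \<gamma> D f)"
    if D [measurable]: "D \<in> sets borel" and g: "g \<in> borel_measurable (restrict_space borel D)"
      and f: "f \<in> borel_measurable (restrict_space borel D)" for D g f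
  proof -
    have bound: "orlicz_norm \<gamma> D (\<lambda>r. (g r)\<^sup>2 / 2 + f r) \<le> ennreal (C * (a\<^sup>2 + b))"
      if "orlicz_norm \<beta> D g < ennreal a" "orlicz_norm \<gamma> D f < ennreal b" for a b
    proof -
      note a = orlicz_norm_admissible[OF assms that(1)]
      note b = orlicz_norm_admissible[OF \<gamma> that(2)]
      define l where "l = C * (a\<^sup>2 + b)"
      have l: "0 < l" using a b C by (simp add: l_def add_pos_pos)
      have la: "a\<^sup>2 / k \<le> l" and lb: "2 * b / k' \<le> l"
        using a b k(1) k'(1) by (auto simp: l_def C_def algebra_simps add_increasing2 add_increasing)
      let ?G = "\<lambda>r. ennreal (1/2 * Phi \<beta> (\<bar>g r\<bar> / a))"
      let ?F = "\<lambda>r. ennreal (1/2 * Phi \<gamma> (\<bar>f r\<bar> / b))"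
      have pointwise: "ennreal (Phi \<gamma> (\<bar>(g r)\<^sup>2 / 2 + f r\<bar> / l)) \<le> ?G r + ?F r" for r
      proof -
        have 1: "Phi \<gamma> ((g r)\<^sup>2 / l) \<le> 1/2 * Phi \<beta> (\<bar>g r\<bar> / a)"
        proof -
          have "(g r)\<^sup>2 / l \<le> (g r)\<^sup>2 / (a\<^sup>2 / k)"
            using la l a k(1) by (intro divide_left_mono) auto
          also have "\<dots> = k * (\<bar>g r\<bar> / a)\<^sup>2" by (simp add: power_divide)
          finally show ?thesis
            using Phi_mono[OF \<gamma>, of "(g r)\<^sup>2 / l" "k * (\<bar>g r\<bar> / a)\<^sup>2"] k(2)[of "\<bar>g r\<bar> / a"] l a
            by fastforce
        qed
        have 2: "Phi \<gamma> (2 * \<bar>f r\<bar> / l) \<le> 1/2 * Phi \<gamma> (\<bar>f r\<bar> / b)"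
        proof -
          have "2 * \<bar>f r\<bar> / l \<le> 2 * \<bar>f r\<bar> / (2 * b / k')"
            using lb l b k'(1) by (intro divide_left_mono) auto
          also have "\<dots> = k' * (\<bar>f r\<bar> / b)" by simp
          finally show ?thesis
            using Phi_mono[OF \<gamma>, of "2 * \<bar>f r\<bar> / l" "k' * (\<bar>f r\<bar> / b)"] k'(2)[of "\<bar>f r\<bar> / b"] l b
            by fastforce
        qed
        have "\<bar>(g r)\<^sup>2 / 2 + f r\<bar> \<le> max ((g r)\<^sup>2) (2 * \<bar>f r\<bar>)"
          using zero_le_power2[of "g r"] by linarith
        then have "\<bar>(g r)\<^sup>2 / 2 + f r\<bar> / l \<le> max ((g r)\<^sup>2) (2 * \<bar>f r\<bar>) / l"
          using l by (intro divide_right_mono) auto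
        then have "Phi \<gamma> (\<bar>(g r)\<^sup>2 / 2 + f r\<bar> / l) \<le> Phi \<gamma> (max ((g r)\<^sup>2) (2 * \<bar>f r\<bar>) / l)"
          using l by (intro Phi_mono \<gamma>) auto
        also have "\<dots> \<le> Phi \<gamma> ((g r)\<^sup>2 / l) + Phi \<gamma> (2 * \<bar>f r\<bar> / l)"
          using Phi_nonneg[OF \<gamma>, of "(g r)\<^sup>2 / l"] Phi_nonneg[OF \<gamma>, of "2 * \<bar>f r\<bar> / l"] l
          by (simp add: max_def)
        also have "\<dots> \<le> 1/2 * Phi \<beta> (\<bar>g r\<bar> / a) + 1/2 * Phi \<gamma> (\<bar>f r\<bar> / b)"
          using 1 2 by (rule add_mono)
        finally have "ennreal (Phi \<gamma> (\<bar>(g r)\<^sup>2 / 2 + f r\<bar> / l))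
            \<le> ennreal (1/2 * Phi \<beta> (\<bar>g r\<bar> / a) + 1/2 * Phi \<gamma> (\<bar>f r\<bar> / b))"
          by (rule ennreal_leI)
        also have "\<dots> = ?G r + ?F r"
          using a b Phi_nonneg[OF assms, of "\<bar>g r\<bar> / a"] Phi_nonneg[OF \<gamma>, of "\<bar>f r\<bar> / b"]
          by (intro ennreal_plus) auto
        finally show ?thesis .
      qed
      have meas: "(\<lambda>r. ennreal (c * Phi \<delta> (\<bar>u r\<bar> / d)) * indicator D r) \<in> borel_measurable lborel"
        if [measurable]: "u \<in> borel_measurable (restrict_space borel D)" for u c \<delta> d
      proof -
        have "(\<lambda>r. ennreal (c * Phi \<delta> (\<bar>u r\<bar> / d))) \<in> borel_measurable (restrict_space borel D)"
          by measurable
        then show ?thesis by (subst (asm) borel_measurable_restrict_space_iff_ennreal) auto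
      qed
      have half: "(\<integral>\<^sup>+ r\<in>D. ennreal (1/2 * Phi \<delta> (\<bar>u r\<bar> / d)) \<partial>lborel) \<le> ennreal (1/2)"
        if "0 < \<delta>" "0 < d" "u \<in> borel_measurable (restrict_space borel D)"
          "(\<integral>\<^sup>+ r\<in>D. ennreal (Phi \<delta> (\<bar>u r\<bar> / d)) \<partial>lborel) \<le> 1" for u \<delta> d
      proof -
        have "(\<integral>\<^sup>+ r\<in>D. ennreal (1/2 * Phi \<delta> (\<bar>u r\<bar> / d)) \<partial>lborel)
          = (\<integral>\<^sup>+ r. ennreal (1/2) * (ennreal (Phi \<delta> (\<bar>u r\<bar> / d)) * indicator D r) \<partial>lborel)"
          using Phi_nonneg[OF that(1)] that(2)
          by (intro nn_integral_cong) (simp only: mult.assoc[symmetric], subst ennreal_mult, auto)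
        also have "\<dots> = ennreal (1/2) * (\<integral>\<^sup>+ r\<in>D. ennreal (Phi \<delta> (\<bar>u r\<bar> / d)) \<partial>lborel)"
          using meas[OF that(3), of 1 \<delta> d] by (intro nn_integral_cmult) simp
        also have "\<dots> \<le> ennreal (1/2) * 1" by (intro mult_left_mono that) auto
        finally show ?thesis by simp
      qed
      have "(\<integral>\<^sup>+ r\<in>D. ennreal (Phi \<gamma> (\<bar>(g r)\<^sup>2 / 2 + f r\<bar> / l)) \<partial>lborel)
          \<le> (\<integral>\<^sup>+ r. ?G r * indicator D r + ?F r * indicator D r \<partial>lborel)"
        using pointwise by (intro nn_integral_mono) (simp add: indicator_def)
      also have "\<dots> = (\<integral>\<^sup>+ r\<in>D. ?G r \<partial>lborel) + (\<integral>\<^sup>+ r\<in>D. ?F r \<partial>lborel)"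
        by (intro nn_integral_add meas f g)
      also have "\<dots> \<le> ennreal (1/2) + ennreal (1/2)"
        using a b by (intro add_mono half assms \<gamma> f g) auto
      also have "\<dots> = ennreal 1" by (subst ennreal_plus[symmetric]) auto
      finally show ?thesis using orlicz_norm_le[OF l] by (simp add: l_def[symmetric])
    qed
    \<comment> \<open>The infimum need not be attained by an admissible value if it is \<open>0\<close>; hence the limit from
      above.\<close>
    show ?thesis
    proof (cases "orlicz_norm \<beta> D g = \<infinity> \<or> orlicz_norm \<gamma> D f = \<infinity>")
      case True
      then show ?thesis using C by (auto simp: ennreal_mult_eq_top_iff power2_eq_square)
    next
      case False
      then obtain u v where uv: "orlicz_norm \<beta> D g = ennreal u" "0 \<le> u"
          "orlicz_norm \<gamma> D f = ennreal v" "0 \<le> v"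
        by (metis ennreal_cases infinity_ennreal_def)
      have "((\<lambda>e. ennreal (C * ((u + e)\<^sup>2 + (v + e)))) \<longlongrightarrow> ennreal (C * ((u + 0)\<^sup>2 + (v + 0))))
          (at_right 0)"
        by (intro tendsto_intros)
      moreover have "eventually (\<lambda>e. orlicz_norm \<gamma> D (\<lambda>r. (g r)\<^sup>2 / 2 + f r)
          \<le> ennreal (C * ((u + e)\<^sup>2 + (v + e)))) (at_right 0)"
        using eventually_at_right_less[of "0::real"]
        by eventually_elim (intro bound, auto simp: uv intro!: ennreal_lessI)
      ultimately have "orlicz_norm \<gamma> D (\<lambda>r. (g r)\<^sup>2 / 2 + f r) \<le> ennreal (C * ((u + 0)\<^sup>2 + (v + 0)))"
        by (rule tendsto_lowerbound) simp
      then show ?thesis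
        using uv C by (simp add: ennreal_mult ennreal_plus ennreal_power)
    qed
  qed
  then show ?thesis using C by (intro that[of C]) (simp_all add: \<gamma>_def)
qed

section \<open>The \<open>L\<^sup>q\<close> quasi-norm\<close>

lemma ennpow_less_top_iff: "ennpow x p < top \<longleftrightarrow> x < top"
  by (simp add: ennpow_def less_top)

lemma ennpow_mono:
  assumes "0 < p" "x \<le> y"
  shows "ennpow x p \<le> ennpow y p"
proof (cases "y = \<infinity>")
  case False
  then have "y < \<infinity>" by (simp add: less_top)
  with assms(2) have "x < \<infinity>" by simp
  then show ?thesis using assms False
    by (auto simp: ennpow_def intro!: ennreal_leI powr_mono2 enn2real_mono simp: less_top)
qed (simp add: ennpow_def)

lemma ennpow_measurable [measurable]: "(\<lambda>x. ennpow x p) \<in> borel_measurable borel"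
  unfolding ennpow_def by measurable

lemma ennpow_square_add:
  assumes "0 < p" "0 < C"
  shows "ennpow (ennreal C * (x\<^sup>2 + y)) (p / 2)
    \<le> ennreal ((2 * C) powr (p / 2)) * (ennpow x p + ennpow y (p / 2))"
proof (cases "x = \<infinity> \<or> y = \<infinity>")
  case True
  then show ?thesis using assms by (auto simp: ennpow_def ennreal_mult_eq_top_iff)
next
  case False
  then obtain u v where uv: "x = ennreal u" "0 \<le> u" "y = ennreal v" "0 \<le> v"
    by (metis ennreal_cases infinity_ennreal_def)
  have sq: "(u\<^sup>2) powr (p / 2) = u powr p"
    using uv by (cases "u = 0") (simp_all add: powr_powr flip: powr_numeral)
  have "(C * (u\<^sup>2 + v)) powr (p / 2) \<le> ((2 * C) * max (u\<^sup>2) v) powr (p / 2)"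
    using assms uv by (intro powr_mono2) (auto simp: max_def)
  also have "\<dots> = (2 * C) powr (p / 2) * (max (u\<^sup>2) v) powr (p / 2)"
    using assms uv by (simp add: powr_mult)
  also have "\<dots> \<le> (2 * C) powr (p / 2) * (u powr p + v powr (p / 2))"
    by (intro mult_left_mono) (auto simp: max_def sq)
  finally have le: "(C * (u\<^sup>2 + v)) powr (p / 2)
      \<le> (2 * C) powr (p / 2) * (u powr p + v powr (p / 2))" .
  have "ennreal C * (x\<^sup>2 + y) = ennreal (C * (u\<^sup>2 + v))"
    using uv assms by (simp add: ennreal_mult ennreal_plus ennreal_power)
  then show ?thesis
    using uv assms le by (simp add: ennpow_def flip: ennreal_mult ennreal_plus)
qed

text \<open>For \<open>q < \<infinity>\<close> this is \<open>(f\<^sup>2) powr (q / 2) = f powr q\<close> and quasi-subadditivity of powers; for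
  \<open>q = \<infinity>\<close> it says that \<open>C * (f\<^sup>2 + g)\<close> is essentially bounded when \<open>f\<close> and \<open>g\<close> are.\<close>

lemma Lq_norm_square_add_finite:
  assumes [measurable]: "f \<in> borel_measurable M" "g \<in> borel_measurable M" "h \<in> borel_measurable M"
    and q: "0 < q" and C: "0 < C"
    and le: "\<And>x. x \<in> space M \<Longrightarrow> h x \<le> ennreal C * ((f x)\<^sup>2 + g x)"
    and fin: "Lq_norm M q f < \<infinity>" "Lq_norm M (q / 2) g < \<infinity>"
  shows "Lq_norm M (q / 2) h < \<infinity>"
proof (cases "q = \<infinity>")
  case True
  then have q2: "q / 2 = \<infinity>" by (simp add: ennreal_divide_eq_top_iff)
  have "AE x in M. h x \<le> ennreal C * ((esssup M f)\<^sup>2 + esssup M g)"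
    using esssup_AE[of f M] esssup_AE[of g M] AE_space
  proof eventually_elim
    case (elim x)
    have "h x \<le> ennreal C * ((f x)\<^sup>2 + g x)" using elim le by simp
    also have "\<dots> \<le> ennreal C * ((esssup M f)\<^sup>2 + esssup M g)"
      using elim by (intro mult_left_mono add_mono power_mono) auto
    finally show ?case .
  qed
  then have "esssup M h \<le> ennreal C * ((esssup M f)\<^sup>2 + esssup M g)" by (intro esssup_I) auto
  also have "\<dots> < \<infinity>"
    using fin q2 True by (simp add: Lq_norm_def ennreal_mult_less_top power_less_top_ennreal)
  finally show ?thesis using q2 by (simp add: Lq_norm_def)
next
  case False
  then obtain p where p: "q = ennreal p" "0 < p"
    using q by (cases q) auto
  have q2: "q / 2 = ennreal (p / 2)" using p by (simp add: divide_ennreal flip: ennreal_numeral)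
  have fin': "(\<integral>\<^sup>+ x. ennpow (f x) p \<partial>M) < \<infinity>" "(\<integral>\<^sup>+ x. ennpow (g x) (p / 2) \<partial>M) < \<infinity>"
    using fin p q2 by (auto simp: Lq_norm_def ennpow_less_top_iff)
  define K where "K = (2 * C) powr (p / 2)"
  have "(\<integral>\<^sup>+ x. ennpow (h x) (p / 2) \<partial>M)
      \<le> (\<integral>\<^sup>+ x. ennreal K * (ennpow (f x) p + ennpow (g x) (p / 2)) \<partial>M)"
  proof (rule nn_integral_mono)
    fix x assume "x \<in> space M"
    then have "ennpow (h x) (p / 2) \<le> ennpow (ennreal C * ((f x)\<^sup>2 + g x)) (p / 2)"
      using p le by (intro ennpow_mono) auto
    also have "\<dots> \<le> ennreal K * (ennpow (f x) p + ennpow (g x) (p / 2))"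
      unfolding K_def by (intro ennpow_square_add p C)
    finally show "ennpow (h x) (p / 2) \<le> ennreal K * (ennpow (f x) p + ennpow (g x) (p / 2))" .
  qed
  also have "\<dots> = ennreal K * ((\<integral>\<^sup>+ x. ennpow (f x) p \<partial>M) + (\<integral>\<^sup>+ x. ennpow (g x) (p / 2) \<partial>M))"
    by (simp add: nn_integral_cmult nn_integral_add)
  also have "\<dots> < \<infinity>" using fin' by (simp add: ennreal_mult_less_top)
  finally show ?thesis
    using p q2 by (simp add: Lq_norm_def ennpow_less_top_iff)
qed

section \<open>The Besov--Orlicz integrands\<close>

lemma mono_ennreal_borel_measurable:
  fixes f :: "real \<Rightarrow> ennreal"
  assumes "mono f"
  shows "f \<in> borel_measurable borel"
proof (rule borel_measurableI_greater)
  fix y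
  have "is_interval {x. y < f x}"
    unfolding is_interval_1 using assms by (auto dest: monoD intro: less_le_trans)
  then show "{x \<in> space borel. y < f x} \<in> sets borel"
    by (simp add: real_interval_borel_measurable)
qed

text \<open>A supremum over uncountably many \<open>h\<close> need not be measurable in general; here it is
  because it increases with \<open>\<tau>\<close>.\<close>

lemma besov_integrand_measurable:
  fixes N :: "real \<Rightarrow> ennreal"
  shows "(\<lambda>\<tau>. ennreal (\<tau> powr a) * (SUP h\<in>{0..\<tau>}. N h)) \<in> borel_measurable (log_measure T)"
proof -
  have [measurable]: "(\<lambda>\<tau>. SUP h\<in>{0..\<tau>}. N h) \<in> borel_measurable borel"
    by (intro mono_ennreal_borel_measurable monoI SUP_subset_mono) auto
  have "(\<lambda>\<tau>. ennreal (\<tau> powr a) * (SUP h\<in>{0..\<tau>}. N h)) \<in> borel_measurable borel"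
    by measurable
  then show ?thesis
    by (simp add: log_measure_def measurable_restrict_space1 cong: measurable_cong_sets)
qed

lemma SUP_square_add_le:
  fixes N N1 N2 :: "'a \<Rightarrow> ennreal"
  assumes "\<And>h. h \<in> H \<Longrightarrow> N h \<le> C * ((N1 h)\<^sup>2 + N2 h)"
  shows "(SUP h\<in>H. N h) \<le> C * ((SUP h\<in>H. N1 h)\<^sup>2 + (SUP h\<in>H. N2 h))"
proof (rule SUP_least)
  fix h assume h: "h \<in> H"
  have "N h \<le> C * ((N1 h)\<^sup>2 + N2 h)" using assms h .
  also have "\<dots> \<le> C * ((SUP h\<in>H. N1 h)\<^sup>2 + (SUP h\<in>H. N2 h))"
    using h by (intro mult_left_mono add_mono power_mono SUP_upper) auto
  finally show "N h \<le> C * ((SUP h\<in>H. N1 h)\<^sup>2 + (SUP h\<in>H. N2 h))" .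
qed

lemma simplex2_slice_measurable:
  assumes "(\<lambda>(s, t). \<Xi> s t) \<in> borel_measurable (restrict_space borel (simplex2 T))" "0 \<le> h"
  shows "(\<lambda>r. \<Xi> r (r + h)) \<in> borel_measurable (restrict_space borel {0..T - h})"
proof -
  have "(\<lambda>r. (r, r + h)) \<in> restrict_space borel {0..T - h} \<rightarrow>\<^sub>M restrict_space borel (simplex2 T)"
    using assms(2)
    by (intro measurable_restrict_space3 borel_measurable_Pair) (auto simp: simplex2_def)
  from measurable_compose[OF this assms(1)] show ?thesis by simp
qed

lemma incr_simplex2_measurable:
  assumes "f \<in> borel_measurable (restrict_space borel {0..T})"
  shows "(\<lambda>(s, t). incr f s t) \<in> borel_measurable (restrict_space borel (simplex2 T))"
proof -
  have "fst \<in> restrict_space borel (simplex2 T) \<rightarrow>\<^sub>M restrict_space (borel :: real measure) {0..T}"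
    "snd \<in> restrict_space borel (simplex2 T) \<rightarrow>\<^sub>M restrict_space (borel :: real measure) {0..T}"
    by (intro measurable_restrict_space3;
        auto simp: simplex2_def intro!: borel_measurable_continuous_onI continuous_intros)+
  from this[THEN measurable_compose, OF assms] show ?thesis
    by (auto simp: incr_def case_prod_beta)
qed

section \<open>The lift of a path by its squared increments\<close>

theorem theorem4p6:
  fixes T \<alpha> \<beta> :: real and q :: ennreal
    and X :: "real \<Rightarrow> real" and F \<X> :: "real \<Rightarrow> real \<Rightarrow> real"
  assumes "0 < T" and "1 / 3 < \<alpha>" and "\<alpha> \<le> 1 / 2" and "0 < \<beta>" and "0 < q"
    and "X \<in> besov T \<alpha> \<beta> q"
    and "F \<in> besov2 T (2 * \<alpha>) (\<beta> / 2) (q / 2)"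
    and "\<And>s u t. 0 \<le> s \<Longrightarrow> s \<le> u \<Longrightarrow> u \<le> t \<Longrightarrow> t \<le> T \<Longrightarrow> F s t - F s u - F u t = 0"
    and "\<And>s t. 0 \<le> s \<Longrightarrow> s \<le> t \<Longrightarrow> t \<le> T \<Longrightarrow> \<X> s t = (X t - X s)\<^sup>2 / 2 + F s t"
  shows "\<X> \<in> besov2 T (2 * \<alpha>) (\<beta> / 2) (q / 2)
    \<and> (\<forall>s u t. 0 \<le> s \<and> s \<le> u \<and> u \<le> t \<and> t \<le> T \<longrightarrow>
          \<X> s t - \<X> s u - \<X> u t = (X u - X s) * (X t - X u))"
proof (intro conjI allI impI)
  fix s u t assume "0 \<le> s \<and> s \<le> u \<and> u \<le> t \<and> t \<le> T"
  then have st: "0 \<le> s" "s \<le> u" "u \<le> t" "t \<le> T" by auto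
  have F: "F s t = F s u + F u t" using assms(8)[OF st] by simp
  have "\<X> s t = (X t - X s)\<^sup>2 / 2 + F s t" "\<X> s u = (X u - X s)\<^sup>2 / 2 + F s u"
    "\<X> u t = (X t - X u)\<^sup>2 / 2 + F u t"
    using st by (auto intro!: assms(9))
  then show "\<X> s t - \<X> s u - \<X> u t = (X u - X s) * (X t - X u)"
    by (simp add: F power2_eq_square field_simps)
next
  have X_meas: "(\<lambda>(s, t). incr X s t) \<in> borel_measurable (restrict_space borel (simplex2 T))"
    using assms(6) by (auto simp: besov_def intro: incr_simplex2_measurable)
  have F_meas: "(\<lambda>(s, t). F s t) \<in> borel_measurable (restrict_space borel (simplex2 T))"
    using assms(7) by (simp add: besov2_def)
  have "(\<lambda>z. (incr X (fst z) (snd z))\<^sup>2 / 2 + F (fst z) (snd z))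
      \<in> borel_measurable (restrict_space borel (simplex2 T))"
    using X_meas F_meas unfolding case_prod_beta by measurable
  then have \<X>_meas: "(\<lambda>(s, t). \<X> s t) \<in> borel_measurable (restrict_space borel (simplex2 T))"
    by (rule measurable_cong[THEN iffD1, rotated])
      (auto simp: simplex2_def space_restrict_space incr_def assms(9))
  obtain C where C: "0 < C" "\<And>D g f. D \<in> sets borel \<Longrightarrow>
      g \<in> borel_measurable (restrict_space borel D) \<Longrightarrow>
      f \<in> borel_measurable (restrict_space borel D) \<Longrightarrow>
      orlicz_norm (\<beta> / 2) D (\<lambda>r. (g r)\<^sup>2 / 2 + f r)
        \<le> ennreal C * ((orlicz_norm \<beta> D g)\<^sup>2 + orlicz_norm (\<beta> / 2) D f)"
    using orlicz_norm_square_add[OF assms(4)] by blast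
  define N where "N h = orlicz_norm (\<beta> / 2) {0..T - h} (\<lambda>r. \<X> r (r + h))" for h
  define NX where "NX h = orlicz_norm \<beta> {0..T - h} (\<lambda>r. incr X r (r + h))" for h
  define NF where "NF h = orlicz_norm (\<beta> / 2) {0..T - h} (\<lambda>r. F r (r + h))" for h
  have N_le: "N h \<le> ennreal C * ((NX h)\<^sup>2 + NF h)" if h: "0 \<le> h" for h
  proof -
    have "N h = orlicz_norm (\<beta> / 2) {0..T - h} (\<lambda>r. (incr X r (r + h))\<^sup>2 / 2 + F r (r + h))"
      unfolding N_def using h by (intro orlicz_norm_cong) (auto simp: incr_def assms(9))
    also have "\<dots> \<le> ennreal C * ((NX h)\<^sup>2 + NF h)"
      unfolding NX_def NF_def
      by (intro C(2) simplex2_slice_measurable[OF X_meas h] simplex2_slice_measurable[OF F_meas h])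
        simp
    finally show ?thesis .
  qed
  have pointwise: "ennreal (\<tau> powr (- (2 * \<alpha>))) * (SUP h\<in>{0..\<tau>}. N h)
      \<le> ennreal C * ((ennreal (\<tau> powr (- \<alpha>)) * (SUP h\<in>{0..\<tau>}. NX h))\<^sup>2
          + ennreal (\<tau> powr (- (2 * \<alpha>))) * (SUP h\<in>{0..\<tau>}. NF h))" for \<tau>
  proof -
    have pw: "ennreal (\<tau> powr (- (2 * \<alpha>))) = (ennreal (\<tau> powr (- \<alpha>)))\<^sup>2"
      by (simp add: power2_eq_square flip: ennreal_mult powr_add)
    have "(SUP h\<in>{0..\<tau>}. N h)
        \<le> ennreal C * ((SUP h\<in>{0..\<tau>}. NX h)\<^sup>2 + (SUP h\<in>{0..\<tau>}. NF h))"
      by (intro SUP_square_add_le N_le) auto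
    from mult_left_mono[OF this, of "ennreal (\<tau> powr (- (2 * \<alpha>)))"] show ?thesis
      unfolding pw by (simp add: power_mult_distrib distrib_left mult_ac)
  qed
  have "besov2_norm T (2 * \<alpha>) (\<beta> / 2) (q / 2) \<X> < \<infinity>"
    unfolding besov2_norm_def N_def[symmetric]
    using assms(6,7)
    by (intro Lq_norm_square_add_finite[OF besov_integrand_measurable besov_integrand_measurable
          besov_integrand_measurable assms(5) C(1) pointwise])
      (auto simp: besov_def besov2_def besov2_norm_def NX_def NF_def)
  with \<X>_meas show "\<X> \<in> besov2 T (2 * \<alpha>) (\<beta> / 2) (q / 2)" by (simp add: besov2_def)
qed

end
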